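(* Let $k\le n$ and let $P\in\mathbb{C}^{n\times k}$ have full column rank. The function $f$ from the set of $n\times n$ Hermitian positive definite matrices to $\mathbb{R}$ given by $$f(X)=\log\det(P^*XP)-\log\det(X)$$ is operator decreasing, i.e. $X\le Y$ implies $f(X)\ge f(Y)$.
   Context: $X\le Y$ denotes the Loewner order: $Y-X$ is positive semidefinite. $P^*$ is the conjugate transpose of $P$. *)

theory Defs
  imports Complex_Main
    "Jordan_Normal_Form.DL_Rank"
    "Jordan_Normal_Form.Schur_Decomposition"
begin

text \<open>
  The order on \<^typ>\<open>complex\<close> is the one of \<^theory>\<open>HOL-Library.Complex_Order\<close>: \<open>0 \<le> z\<close> means
  that \<open>z\<close> is real and nonnegative. The scalar \<open>(A *\<^sub>v v) \<bullet>c v\<close> is \<open>v\<^sup>* A v\<close>.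
\<close>

definition hermitian_mat :: "nat \<Rightarrow> complex mat \<Rightarrow> bool" where
  "hermitian_mat n A \<longleftrightarrow> A \<in> carrier_mat n n \<and> mat_adjoint A = A"

definition psd_mat :: "nat \<Rightarrow> complex mat \<Rightarrow> bool" where
  "psd_mat n A \<longleftrightarrow> hermitian_mat n A \<and> (\<forall>v \<in> carrier_vec n. 0 \<le> (A *\<^sub>v v) \<bullet>c v)"

definition pd_mat :: "nat \<Rightarrow> complex mat \<Rightarrow> bool" where
  "pd_mat n A \<longleftrightarrow> hermitian_mat n A \<and>
     (\<forall>v \<in> carrier_vec n. v \<noteq> 0\<^sub>v n \<longrightarrow> 0 < (A *\<^sub>v v) \<bullet>c v)"

definition loewner_le :: "nat \<Rightarrow> complex mat \<Rightarrow> complex mat \<Rightarrow> bool" where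
  "loewner_le n X Y \<longleftrightarrow> psd_mat n (Y - X)"

text \<open>
  \<^const>\<open>det\<close> of a complex matrix is a complex number. For a Hermitian positive definite
  matrix it is real and positive (\<open>det_pd_pos\<close> below), so taking the real part loses nothing;
  this applies to \<open>X\<close> and, when \<open>P\<close> has full column rank, also to \<open>P\<^sup>* X P\<close>.
\<close>

definition log_det :: "complex mat \<Rightarrow> real" where
  "log_det A = ln (Re (det A))"

definition log_det_diff :: "complex mat \<Rightarrow> complex mat \<Rightarrow> real" where
  "log_det_diff P X = log_det (mat_adjoint P * X * P) - log_det X"

lemma pd_eigenvalue_pos:
  assumes A: "pd_mat n A" and e: "eigenvalue A e"
  shows "0 < e"
proof -
  have C: "A \<in> carrier_mat n n" using A by (simp add: pd_mat_def hermitian_mat_def)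
  obtain v where v: "v \<in> carrier_vec n" "v \<noteq> 0\<^sub>v n" "A *\<^sub>v v = e \<cdot>\<^sub>v v"
    using e C unfolding eigenvalue_def eigenvector_def by auto
  have "0 < (A *\<^sub>v v) \<bullet>c v" using A v(1,2) unfolding pd_mat_def by blast
  also have "(A *\<^sub>v v) \<bullet>c v = e * (v \<bullet>c v)" using v by simp
  finally have 1: "0 < e * (v \<bullet>c v)" .
  have "0 < v \<bullet>c v" using v by simp
  with 1 show ?thesis by (auto simp: less_complex_def zero_less_mult_iff)
qed

lemma det_pd_pos:
  assumes A: "pd_mat n A"
  shows "0 < det A"
proof -
  have C: "A \<in> carrier_mat n n" using A by (simp add: pd_mat_def hermitian_mat_def)
  obtain es where es: "char_poly A = (\<Prod>e\<leftarrow>es. [:- e, 1:])"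
    using char_poly_factorized[OF C] by blast
  obtain B P Q where s: "schur_decomposition A es = (B, P, Q)"
    by (cases "schur_decomposition A es") auto
  note S = schur_decomposition[OF C es s]
  have sim: "similar_mat A B" using S unfolding similar_mat_def by blast
  have B: "B \<in> carrier_mat n n" using similar_matD[OF sim] C by auto
  have "det A = det B" by (rule det_similar[OF sim])
  also have "\<dots> = prod_list (diag_mat B)" using S B by (intro det_upper_triangular) auto
  finally have d: "det A = prod_list es" using S by simp
  have "0 < e" if "e \<in> set es" for e
  proof (rule pd_eigenvalue_pos[OF A])
    have "poly (char_poly A) e = 0"
      using that unfolding es poly_prod_list by (force simp: prod_list_zero_iff)
    then show "eigenvalue A e" using eigenvalue_root_char_poly[OF C] by simp
  qed
  then have "0 < prod_list es"
    by (induction es) (auto simp: less_complex_def zero_less_mult_iff)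
  then show ?thesis using d by simp
qed

end

theory Submission
  imports Defs
begin

text \<open>
  Induction on \<open>n - k\<close>. For \<open>k = n\<close> the function is the constant \<open>ln \<bar>det P\<bar>\<^sup>2\<close>. For \<open>k < n\<close>,
  append to \<open>P\<close> a nonzero column \<open>p\<close> with \<open>P\<^sup>* p = 0\<close>, giving \<open>R\<close>, and put \<open>M = R\<^sup>* X R\<close>, whose
  leading \<open>k \<times> k\<close> block is \<open>P\<^sup>* X P\<close>. The ratio \<open>det M / det (P\<^sup>* X P)\<close> is a Schur complement,
  hence the minimum of \<open>w\<^sup>* M w\<close> over the vectors \<open>w\<close> with last entry \<open>1\<close>, and such a minimum is
  monotone in \<open>X\<close>. So passing from \<open>P\<close> to \<open>R\<close> only adds an increasing function of \<open>X\<close>.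
\<close>

section \<open>Adjoints and congruence by a rectangular matrix\<close>

lemma mat_adjoint_eq_transpose: "mat_adjoint A = (map_mat conjugate A)\<^sup>T"
  unfolding mat_adjoint_def by (rule eq_matI) (auto simp: mat_of_rows_def)

lemma mat_adjoint_carrier: "A \<in> carrier_mat n k \<Longrightarrow> mat_adjoint A \<in> carrier_mat k n"
  by (simp add: mat_adjoint_eq_transpose)

lemma row_mat_adjoint: "A \<in> carrier_mat n k \<Longrightarrow> i < k \<Longrightarrow> row (mat_adjoint A) i = conjugate (col A i)"
  unfolding mat_adjoint_eq_transpose by (intro eq_vecI) auto

lemma conjugate_mult_mat_vec:
  fixes A :: "complex mat"
  assumes "A \<in> carrier_mat n k" "v \<in> carrier_vec k"
  shows "map_mat conjugate A *\<^sub>v conjugate v = conjugate (A *\<^sub>v v)"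
proof (rule eq_vecI)
  fix i assume "i < dim_vec (conjugate (A *\<^sub>v v))"
  then have i: "i < n" using assms by simp
  have "row (map_mat conjugate A) i = conjugate (row A i)"
    using assms i by (intro eq_vecI) auto
  then show "(map_mat conjugate A *\<^sub>v conjugate v) $ i = conjugate (A *\<^sub>v v) $ i"
    using assms i by (simp add: conjugate_sprod_vec[of "row A i" k v, symmetric])
qed (use assms in auto)

lemma mat_adjoint_cscalar_prod:
  fixes A :: "complex mat"
  assumes "A \<in> carrier_mat n k" "v \<in> carrier_vec n" "w \<in> carrier_vec k"
  shows "(mat_adjoint A *\<^sub>v v) \<bullet>c w = v \<bullet>c (A *\<^sub>v w)"
  unfolding mat_adjoint_eq_transpose conjugate_mult_mat_vec[OF assms(1,3), symmetric]
  using assms by (intro transpose_vec_mult_scalar) auto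

lemma mat_adjoint_mult:
  fixes A B :: "complex mat"
  assumes A: "A \<in> carrier_mat n k" and B: "B \<in> carrier_mat k m"
  shows "mat_adjoint (A * B) = mat_adjoint B * mat_adjoint A"
proof -
  have "map_mat conjugate (A * B) = map_mat conjugate A * map_mat conjugate B"
    using A B by (intro eq_matI)
      (auto simp: scalar_prod_def sum_conjugate conjugate_dist_mul)
  then show ?thesis
    unfolding mat_adjoint_eq_transpose using A B by (simp add: transpose_mult[of _ n k _ m])
qed

lemma mat_adjoint_adjoint: "mat_adjoint (mat_adjoint A) = A"
  unfolding mat_adjoint_eq_transpose by (intro eq_matI) auto

lemma hermitian_cscalar_prod:
  assumes "hermitian_mat n M" "v \<in> carrier_vec n" "w \<in> carrier_vec n"
  shows "(M *\<^sub>v v) \<bullet>c w = v \<bullet>c (M *\<^sub>v w)"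
  using mat_adjoint_cscalar_prod[of M n n v w] assms by (simp add: hermitian_mat_def)

text \<open>Moving \<open>R\<close> across the inner product is what transports both positivity and
  the comparison of \<open>X\<close> with \<open>Y\<close> to the congruent matrices.\<close>

lemma congruence_quadratic_form:
  fixes X R :: "complex mat"
  assumes X: "X \<in> carrier_mat n n" and R: "R \<in> carrier_mat n m" and w: "w \<in> carrier_vec m"
  shows "((mat_adjoint R * X * R) *\<^sub>v w) \<bullet>c w = (X *\<^sub>v (R *\<^sub>v w)) \<bullet>c (R *\<^sub>v w)"
proof -
  note Ra = mat_adjoint_carrier[OF R]
  have "(mat_adjoint R * X * R) *\<^sub>v w = mat_adjoint R *\<^sub>v (X *\<^sub>v (R *\<^sub>v w))"
    using Ra X R w by (simp add: assoc_mult_mat_vec[of _ m n _ n] assoc_mult_mat_vec[of _ m n _ m])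
  then show ?thesis
    using mat_adjoint_cscalar_prod[OF R _ w, of "X *\<^sub>v (R *\<^sub>v w)"] X R w by simp
qed

lemma pd_mat_congruence:
  assumes X: "pd_mat n X" and R: "R \<in> carrier_mat n m"
    and inj: "\<And>w. w \<in> carrier_vec m \<Longrightarrow> R *\<^sub>v w = 0\<^sub>v n \<Longrightarrow> w = 0\<^sub>v m"
  shows "pd_mat m (mat_adjoint R * X * R)"
proof -
  note Ra = mat_adjoint_carrier[OF R]
  have XC: "X \<in> carrier_mat n n" and Xa: "mat_adjoint X = X"
    using X by (auto simp: pd_mat_def hermitian_mat_def)
  have "mat_adjoint (mat_adjoint R * X * R) = mat_adjoint R * (X * R)"
    using mat_adjoint_mult[OF mult_carrier_mat[OF Ra XC] R] mat_adjoint_mult[OF Ra XC]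
    by (simp add: Xa mat_adjoint_adjoint)
  also have "\<dots> = mat_adjoint R * X * R"
    using Ra XC R by (simp add: assoc_mult_mat[of _ m n _ n _ m])
  finally have "hermitian_mat m (mat_adjoint R * X * R)"
    using Ra XC R by (simp add: hermitian_mat_def)
  moreover have "0 < ((mat_adjoint R * X * R) *\<^sub>v w) \<bullet>c w"
    if w: "w \<in> carrier_vec m" "w \<noteq> 0\<^sub>v m" for w
    unfolding congruence_quadratic_form[OF XC R w(1)]
    using X inj w R unfolding pd_mat_def by (metis mult_mat_vec_carrier)
  ultimately show ?thesis unfolding pd_mat_def by blast
qed

section \<open>Schur complement of the last entry as a minimum\<close>

lemma schur_complement_vector:
  fixes M :: "complex mat"
  assumes M: "M \<in> carrier_mat (Suc m) (Suc m)" and D: "det (mat_delete M m m) \<noteq> 0"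
  obtains v where "v \<in> carrier_vec (Suc m)" "v $ m = 1"
    "M *\<^sub>v v = (det M / det (mat_delete M m m)) \<cdot>\<^sub>v unit_vec (Suc m) m"
proof -
  let ?d = "det (mat_delete M m m)"
  \<comment> \<open>Up to scaling the minimiser is \<open>M\<^sup>-\<^sup>1 e\<^sub>m\<close>, i.e. the last column of the adjugate.\<close>
  define u where "u = col (adj_mat M) m"
  note a = adj_mat[OF M]
  have u: "u \<in> carrier_vec (Suc m)" using a(1) by (auto intro!: carrier_vecI simp: u_def)
  \<comment> \<open>The last diagonal cofactor has sign (-1)^(m+m) = 1, so it is the deleted minor
    itself.\<close>
  have um: "u $ m = ?d" using M by (simp add: u_def adj_mat_def cofactor_def)
  have "M *\<^sub>v u = col (M * adj_mat M) m"
    using M a(1) unfolding u_def by (intro col_mult2[symmetric]) auto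
  also have "\<dots> = det M \<cdot>\<^sub>v unit_vec (Suc m) m"
    unfolding a(2) by (intro eq_vecI) auto
  finally have Mu: "M *\<^sub>v u = det M \<cdot>\<^sub>v unit_vec (Suc m) m" .
  show ?thesis
  proof (rule that[of "(1 / ?d) \<cdot>\<^sub>v u"])
    show "M *\<^sub>v ((1 / ?d) \<cdot>\<^sub>v u) = (det M / ?d) \<cdot>\<^sub>v unit_vec (Suc m) m"
      using M u by (simp add: mult_mat_vec[OF M u] Mu smult_smult_assoc)
  qed (use u um D in auto)
qed

text \<open>Write w = v + x, so that x vanishes at index m. Since \<open>M\<close> sends v to a
  multiple of the unit vector at m, both cross terms vanish, and the form at w equals r plus the
  nonnegative form at x.\<close>

lemma schur_complement_le_quadratic_form:
  assumes M: "pd_mat n M" and m: "m < n"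
    and v: "v \<in> carrier_vec n" "v $ m = 1" "M *\<^sub>v v = r \<cdot>\<^sub>v unit_vec n m"
    and w: "w \<in> carrier_vec n" "w $ m = 1"
  shows "r \<le> (M *\<^sub>v w) \<bullet>c w"
proof -
  have H: "hermitian_mat n M" and MC: "M \<in> carrier_mat n n"
    using M by (auto simp: pd_mat_def hermitian_mat_def)
  define x where "x = w - v"
  have x: "x \<in> carrier_vec n" "x $ m = 0" and wx: "w = v + x"
    using v w m by (auto simp: x_def)
  have Mv: "M *\<^sub>v v \<in> carrier_vec n" "M *\<^sub>v x \<in> carrier_vec n" using MC v x by auto
  have cv: "conjugate v \<in> carrier_vec n" "conjugate x \<in> carrier_vec n" "conjugate w \<in> carrier_vec n"
    using v w x by auto
  have 1: "(M *\<^sub>v v) \<bullet>c w = r" using v w m by simp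
  have "(M *\<^sub>v x) \<bullet>c v = x \<bullet>c (M *\<^sub>v v)" by (rule hermitian_cscalar_prod[OF H x(1) v(1)])
  also have "\<dots> = conjugate ((M *\<^sub>v v) \<bullet>c x)"
    using Mv(1) x(1) by (metis conjugate_conjugate_sprod conjugate_id conjugate_vec_sprod_comm)
  also have "(M *\<^sub>v v) \<bullet>c x = 0" using v x m by simp
  finally have 2: "(M *\<^sub>v x) \<bullet>c v = 0" by simp
  have 3: "0 \<le> (M *\<^sub>v x) \<bullet>c x"
  proof (cases "x = 0\<^sub>v n")
    case True
    then show ?thesis using Mv by simp
  next
    case False
    then show ?thesis using M x unfolding pd_mat_def by (simp add: less_imp_le)
  qed
  have "(M *\<^sub>v w) \<bullet>c w = (M *\<^sub>v v) \<bullet>c w + (M *\<^sub>v x) \<bullet>c w"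
    using add_scalar_prod_distrib[OF Mv cv(3)] mult_add_distrib_mat_vec[OF MC v(1) x(1)] wx by simp
  also have "(M *\<^sub>v x) \<bullet>c w = (M *\<^sub>v x) \<bullet>c v + (M *\<^sub>v x) \<bullet>c x"
    using scalar_prod_add_distrib[OF Mv(2) cv(1,2)] conjugate_add_vec[OF v(1) x(1)] wx by simp
  finally show ?thesis using 1 2 3 by simp
qed

text \<open>Evaluate both forms at the minimiser w of \<open>N\<close>: the minimum for
  \<open>M\<close> is at most the form of \<open>M\<close> at w, which is at most the form of
  \<open>N\<close> at w, and that is the minimum for \<open>N\<close>.\<close>

lemma schur_complement_mono:
  assumes M: "pd_mat (Suc m) M" and N: "pd_mat (Suc m) N"
    and le: "\<And>v. v \<in> carrier_vec (Suc m) \<Longrightarrow> (M *\<^sub>v v) \<bullet>c v \<le> (N *\<^sub>v v) \<bullet>c v"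
    and D: "det (mat_delete M m m) \<noteq> 0" "det (mat_delete N m m) \<noteq> 0"
  shows "det M / det (mat_delete M m m) \<le> det N / det (mat_delete N m m)"
proof -
  have MC: "M \<in> carrier_mat (Suc m) (Suc m)" and NC: "N \<in> carrier_mat (Suc m) (Suc m)"
    using M N by (auto simp: pd_mat_def hermitian_mat_def)
  obtain v where v: "v \<in> carrier_vec (Suc m)" "v $ m = 1"
    "M *\<^sub>v v = (det M / det (mat_delete M m m)) \<cdot>\<^sub>v unit_vec (Suc m) m"
    using schur_complement_vector[OF MC D(1)] .
  obtain w where w: "w \<in> carrier_vec (Suc m)" "w $ m = 1"
    "N *\<^sub>v w = (det N / det (mat_delete N m m)) \<cdot>\<^sub>v unit_vec (Suc m) m"
    using schur_complement_vector[OF NC D(2)] .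
  have "det M / det (mat_delete M m m) \<le> (M *\<^sub>v w) \<bullet>c w"
    by (rule schur_complement_le_quadratic_form[OF M _ v w(1,2)]) simp
  also have "\<dots> \<le> (N *\<^sub>v w) \<bullet>c w" by (rule le[OF w(1)])
  also have "\<dots> = det N / det (mat_delete N m m)" using w by simp
  finally show ?thesis .
qed

section \<open>Appending an orthogonal column\<close>

lemma wide_mat_kernel_nontrivial:
  fixes A :: "'a :: field mat"
  assumes A: "A \<in> carrier_mat k n" and k: "k < n"
  obtains p where "p \<in> carrier_vec n" "p \<noteq> 0\<^sub>v n" "A *\<^sub>v p = 0\<^sub>v k"
proof -
  \<comment> \<open>Padding with zero rows makes the matrix square, so the determinant criterion for
    a nontrivial kernel applies. Row k of \<open>B\<close> is zero, hence its transpose kills the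
    unit vector at k and the determinant vanishes.\<close>
  define B where "B = mat n n (\<lambda>(i, j). if i < k then A $$ (i, j) else 0)"
  have B: "B \<in> carrier_mat n n" by (simp add: B_def)
  have "B\<^sup>T *\<^sub>v unit_vec n k = 0\<^sub>v n"
    using k by (intro eq_vecI) (auto simp: B_def)
  moreover have "unit_vec n k \<noteq> (0\<^sub>v n :: 'a vec)" using k by simp
  ultimately have "det B\<^sup>T = 0"
    using det_0_iff_vec_prod_zero[of "B\<^sup>T" n] B by (auto intro!: exI[of _ "unit_vec n k"])
  then have "det B = 0" using det_transpose[OF B] by simp
  then obtain p where p: "p \<in> carrier_vec n" "p \<noteq> 0\<^sub>v n" "B *\<^sub>v p = 0\<^sub>v n"
    using det_0_iff_vec_prod_zero[OF B] by blast
  have "A *\<^sub>v p = 0\<^sub>v k"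
  proof (rule eq_vecI)
    fix i assume "i < dim_vec (0\<^sub>v k)"
    then have i: "i < k" by simp
    have "row A i = row B i" using i k A by (intro eq_vecI) (auto simp: B_def)
    then show "(A *\<^sub>v p) $ i = 0\<^sub>v k $ i"
      using arg_cong[OF p(3), of "\<lambda>v. v $ i"] i k A B by simp
  qed (use A in simp)
  then show ?thesis using that p by blast
qed

definition snoc_col :: "'a mat \<Rightarrow> 'a vec \<Rightarrow> 'a mat" where
  "snoc_col A p = mat (dim_row A) (Suc (dim_col A)) (\<lambda>(i, j). if j < dim_col A then A $$ (i, j) else p $ i)"

lemma snoc_col_carrier: "A \<in> carrier_mat n k \<Longrightarrow> snoc_col A p \<in> carrier_mat n (Suc k)"
  by (auto simp: snoc_col_def)

lemma col_snoc_col: "A \<in> carrier_mat n k \<Longrightarrow> j < k \<Longrightarrow> col (snoc_col A p) j = col A j"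
  by (intro eq_vecI) (auto simp: snoc_col_def)

lemma snoc_col_mult_vec:
  fixes A :: "'a :: comm_ring mat"
  assumes A: "A \<in> carrier_mat n k" and p: "p \<in> carrier_vec n" and w: "w \<in> carrier_vec (Suc k)"
  shows "snoc_col A p *\<^sub>v w = A *\<^sub>v vec k (($) w) + w $ k \<cdot>\<^sub>v p"
  using assms by (intro eq_vecI) (auto simp: snoc_col_def scalar_prod_def mult.commute)

text \<open>Split w into its first k entries u and its last entry. Pairing P u + w_k p = 0 with p
  removes P u by orthogonality and leaves conj(w_k) times the squared norm of p, so w_k = 0;
  injectivity of \<open>P\<close> then gives u = 0.\<close>

lemma snoc_col_injective:
  fixes P :: "complex mat"
  assumes P: "P \<in> carrier_mat n k"
    and inj: "\<And>w. w \<in> carrier_vec k \<Longrightarrow> P *\<^sub>v w = 0\<^sub>v n \<Longrightarrow> w = 0\<^sub>v k"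
    and p: "p \<in> carrier_vec n" "p \<noteq> 0\<^sub>v n" "mat_adjoint P *\<^sub>v p = 0\<^sub>v k"
    and w: "w \<in> carrier_vec (Suc k)" "snoc_col P p *\<^sub>v w = 0\<^sub>v n"
  shows "w = 0\<^sub>v (Suc k)"
proof -
  define u where "u = vec k (($) w)"
  have u: "u \<in> carrier_vec k" by (simp add: u_def)
  have e: "P *\<^sub>v u + w $ k \<cdot>\<^sub>v p = 0\<^sub>v n"
    using snoc_col_mult_vec[OF P p(1) w(1)] w(2) by (simp add: u_def)
  have Pu: "P *\<^sub>v u \<in> carrier_vec n" using P u by simp
  have "p \<bullet>c (P *\<^sub>v u) = 0"
    using mat_adjoint_cscalar_prod[OF P p(1) u] p(3) u by simp
  moreover have "p \<bullet>c (P *\<^sub>v u + w $ k \<cdot>\<^sub>v p) = p \<bullet>c (P *\<^sub>v u) + conjugate (w $ k) * (p \<bullet>c p)"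
    using p(1) Pu by (simp add: conjugate_add_vec[of _ n] conjugate_smult_vec scalar_prod_add_distrib[of _ n])
  ultimately have "conjugate (w $ k) * (p \<bullet>c p) = 0" using e p(1) by simp
  then have wk: "w $ k = 0" using p by simp
  have "0 \<cdot>\<^sub>v p = 0\<^sub>v n" using p(1) by (intro eq_vecI) auto
  then have "P *\<^sub>v u = 0\<^sub>v n" using e Pu wk by simp
  then have "u = 0\<^sub>v k" using inj u by blast
  then have "w $ i = 0" if "i < k" for i
    using that unfolding u_def by (metis index_vec index_zero_vec(1))
  with wk show ?thesis using w(1) by (intro eq_vecI) (auto simp: less_Suc_eq)
qed

text \<open>Entry (i, j) sees only columns i and j of \<open>R\<close>. Hence appending a column to
  \<open>P\<close> leaves the leading block of the congruent matrix unchanged.\<close>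

lemma congruence_index:
  fixes X R :: "complex mat"
  assumes X: "X \<in> carrier_mat n n" and R: "R \<in> carrier_mat n m" and ij: "i < m" "j < m"
  shows "(mat_adjoint R * X * R) $$ (i, j) = conjugate (col R i) \<bullet> (X *\<^sub>v col R j)"
proof -
  note Ra = mat_adjoint_carrier[OF R]
  have "mat_adjoint R * X * R = mat_adjoint R * (X * R)"
    using Ra X R by (simp add: assoc_mult_mat[of _ m n _ n _ m])
  then show ?thesis
    using Ra X R ij by (simp add: row_mat_adjoint mult_mat_vec_def)
qed

lemma mat_delete_congruence_snoc_col:
  fixes X P :: "complex mat"
  assumes X: "X \<in> carrier_mat n n" and P: "P \<in> carrier_mat n k"
  shows "mat_delete (mat_adjoint (snoc_col P p) * X * snoc_col P p) k k = mat_adjoint P * X * P"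
proof -
  note R = snoc_col_carrier[OF P, of p]
  let ?M = "mat_adjoint (snoc_col P p) * X * snoc_col P p"
  have M: "?M \<in> carrier_mat (Suc k) (Suc k)"
    using mat_adjoint_carrier[OF R] X R by simp
  have PX: "mat_adjoint P * X * P \<in> carrier_mat k k"
    using mat_adjoint_carrier[OF P] X P by simp
  show ?thesis
  proof (rule eq_matI)
    fix i j
    assume "i < dim_row (mat_adjoint P * X * P)" "j < dim_col (mat_adjoint P * X * P)"
    then have ij: "i < k" "j < k" using PX by auto
    have "mat_delete A k k $$ (i, j) = A $$ (i, j)" if "A \<in> carrier_mat (Suc k) (Suc k)" for A :: "complex mat"
      using that ij unfolding mat_delete_def by auto
    then have "mat_delete ?M k k $$ (i, j) = ?M $$ (i, j)" using M by blast
    also have "\<dots> = (mat_adjoint P * X * P) $$ (i, j)"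
      using ij by (simp add: congruence_index[OF X R] congruence_index[OF X P] col_snoc_col[OF P])
    finally show "mat_delete ?M k k $$ (i, j) = (mat_adjoint P * X * P) $$ (i, j)" .
  qed (use carrier_matD[OF mat_delete_carrier[OF M]] carrier_matD[OF PX]
      in \<open>simp_all only: diff_Suc_1\<close>)
qed

section \<open>Induction on the number of missing columns\<close>

lemma log_det_diff_square:
  assumes X: "pd_mat n X" and P: "P \<in> carrier_mat n n"
    and inj: "\<And>w. w \<in> carrier_vec n \<Longrightarrow> P *\<^sub>v w = 0\<^sub>v n \<Longrightarrow> w = 0\<^sub>v n"
  shows "log_det_diff P X = ln (Re (det (mat_adjoint P) * det P))"
proof -
  let ?c = "det (mat_adjoint P) * det P"
  note Pa = mat_adjoint_carrier[OF P]
  have XC: "X \<in> carrier_mat n n" using X by (simp add: pd_mat_def hermitian_mat_def)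
  have d: "det (mat_adjoint P * X * P) = ?c * det X"
    using Pa XC P by (simp add: det_mult[of _ n])
  have X0: "0 < Re (det X)" "Im (det X) = 0"
    using det_pd_pos[OF X] by (auto simp: less_complex_def)
  \<comment> \<open>Splitting the logarithm requires a positive \<open>Re ?c\<close>; this sign is
    inferred from the positive determinants of the congruent matrix and of \<open>X\<close>.\<close>
  have "0 < Re (?c * det X)"
    using det_pd_pos[OF pd_mat_congruence[OF X P inj]] unfolding d by (simp add: less_complex_def)
  moreover have r: "Re (?c * det X) = Re ?c * Re (det X)" using X0 by simp
  ultimately have "0 < Re ?c" using X0 by (simp add: zero_less_mult_iff)
  then show ?thesis
    unfolding log_det_diff_def log_det_def d r using X0 by (simp add: ln_mult_pos del: times_complex.simps)
qed

lemma log_det_diff_antimono: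
  assumes X: "pd_mat n X" and Y: "pd_mat n Y"
    and le: "\<And>v. v \<in> carrier_vec n \<Longrightarrow> (X *\<^sub>v v) \<bullet>c v \<le> (Y *\<^sub>v v) \<bullet>c v"
    and "k \<le> n" "P \<in> carrier_mat n k"
    and "\<And>w. w \<in> carrier_vec k \<Longrightarrow> P *\<^sub>v w = 0\<^sub>v n \<Longrightarrow> w = 0\<^sub>v k"
  shows "log_det_diff P Y \<le> log_det_diff P X"
  using assms(4-6)
\<comment> \<open>The hypothesis is applied to a matrix with one more column, so \<open>k\<close>
  and \<open>P\<close> vary while \<open>X\<close> and \<open>Y\<close> stay fixed.\<close>
proof (induction "n - k" arbitrary: k P)
  case 0
  then have [simp]: "k = n" by simp
  show ?case using 0 X Y by (simp add: log_det_diff_square)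
next
  case (Suc d)
  note P = Suc.prems(2) and inj = Suc.prems(3)
  have XC: "X \<in> carrier_mat n n" and YC: "Y \<in> carrier_mat n n"
    using X Y by (auto simp: pd_mat_def hermitian_mat_def)
  have kn: "k < n" using Suc.hyps(2) by simp
  obtain p where p: "p \<in> carrier_vec n" "p \<noteq> 0\<^sub>v n" "mat_adjoint P *\<^sub>v p = 0\<^sub>v k"
    using wide_mat_kernel_nontrivial[OF mat_adjoint_carrier[OF P] kn] .
  define R where "R = snoc_col P p"
  have R: "R \<in> carrier_mat n (Suc k)" unfolding R_def by (rule snoc_col_carrier[OF P])
  have Rinj: "w = 0\<^sub>v (Suc k)" if "w \<in> carrier_vec (Suc k)" "R *\<^sub>v w = 0\<^sub>v n" for w
    using snoc_col_injective[OF P inj p] that unfolding R_def by blast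
  have IH: "log_det_diff R Y \<le> log_det_diff R X"
    using Suc.hyps(2) kn by (intro Suc.hyps(1)[OF _ _ R Rinj]) auto
  let ?M = "\<lambda>Z. mat_adjoint R * Z * R" and ?D = "\<lambda>Z. mat_adjoint P * Z * P"
  have del: "mat_delete (?M X) k k = ?D X" "mat_delete (?M Y) k k = ?D Y"
    unfolding R_def by (rule mat_delete_congruence_snoc_col[OF XC P] mat_delete_congruence_snoc_col[OF YC P])+
  have DX: "0 < det (?D X)" and DY: "0 < det (?D Y)" and MX: "0 < det (?M X)" and MY: "0 < det (?M Y)"
    by (rule det_pd_pos[OF pd_mat_congruence[OF X P inj]] det_pd_pos[OF pd_mat_congruence[OF Y P inj]]
      det_pd_pos[OF pd_mat_congruence[OF X R Rinj]] det_pd_pos[OF pd_mat_congruence[OF Y R Rinj]]; assumption)+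
  have "det (?M X) / det (?D X) \<le> det (?M Y) / det (?D Y)"
    unfolding del[symmetric]
  proof (rule schur_complement_mono)
    show "pd_mat (Suc k) (?M X)" "pd_mat (Suc k) (?M Y)"
      using pd_mat_congruence[OF X R Rinj] pd_mat_congruence[OF Y R Rinj] by blast+
    show "(?M X *\<^sub>v v) \<bullet>c v \<le> (?M Y *\<^sub>v v) \<bullet>c v" if "v \<in> carrier_vec (Suc k)" for v
      unfolding congruence_quadratic_form[OF XC R that] congruence_quadratic_form[OF YC R that]
      using le R that by simp
    show "det (mat_delete (?M X) k k) \<noteq> 0" "det (mat_delete (?M Y) k k) \<noteq> 0"
      unfolding del using DX DY by auto
  qed
  \<comment> \<open>All four determinants are positive reals, so taking real parts commutes with the
    quotients.\<close>
  then have "Re (det (?M X)) / Re (det (?D X)) \<le> Re (det (?M Y)) / Re (det (?D Y))"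
    using Re_divide_of_real[of _ "Re (det (?D X))"] Re_divide_of_real[of _ "Re (det (?D Y))"] DX DY
    by (metis complex_is_Real_iff less_complex_def less_eq_complex_def of_real_Re zero_complex.sel(2))
  then have "ln (Re (det (?M X)) / Re (det (?D X))) \<le> ln (Re (det (?M Y)) / Re (det (?D Y)))"
    using DX DY MX MY by (subst ln_le_cancel_iff) (auto simp: less_complex_def)
  then have "log_det (?M X) - log_det (?D X) \<le> log_det (?M Y) - log_det (?D Y)"
    using DX DY MX MY by (simp add: log_det_def ln_div less_complex_def)
  \<comment> \<open>For Z equal to \<open>X\<close> or \<open>Y\<close>,
    \<open>log_det_diff P Z\<close> is \<open>log_det_diff R Z\<close> minus the logarithm of the
    Schur complement: a decreasing term minus an increasing one.\<close>
  with IH show ?case unfolding log_det_diff_def by simp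
qed

section \<open>From full column rank to a trivial kernel\<close>

lemma (in vec_space) full_rank_distinct_cols:
  assumes A: "A \<in> carrier_mat n nc" and "rank A = nc"
  shows "distinct (cols A)"
proof -
  obtain S where S: "maximal S (\<lambda>T. T \<subseteq> set (cols A) \<and> lin_indpt T)"
    using maximal_exists_superset[of "set (cols A)" "\<lambda>T. T \<subseteq> set (cols A) \<and> lin_indpt T" "{}"]
      finite_lin_indpt2[of "{}"] by auto
  \<comment> \<open>The rank is the size of a maximal independent subset of the set of columns, so a
    repeated column would force it below \<open>nc\<close>.\<close>
  then have "rank A \<le> card (set (cols A))"
    using rank_card_indpt[OF A S] by (simp add: card_mono maximal_def)
  then have "card (set (cols A)) = length (cols A)"
    using assms card_length[of "cols A"] by simp
  then show ?thesis by (rule card_distinct)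
qed

text \<open>Independence is a property of the set of columns and does not see repetitions. Only
  together with distinctness does it exclude a nonzero kernel vector.\<close>

lemma (in vec_space) full_rank_injective:
  assumes A: "A \<in> carrier_mat n nc" and r: "rank A = nc"
    and v: "v \<in> carrier_vec nc" "A *\<^sub>v v = 0\<^sub>v n"
  shows "v = 0\<^sub>v nc"
  using full_rank_distinct_cols[OF A r] full_rank_lin_indpt[OF A r] lin_depI[OF A v(1) _ v(2)] by blast

theorem proposition4p12:
  fixes P :: "complex mat" and n k :: nat
  assumes "k \<le> n"
    and "P \<in> carrier_mat n k"
    and "vec_space.rank n P = k"
  shows "monotone_on {X. pd_mat n X} (loewner_le n) (\<ge>) (log_det_diff P)"
proof (rule monotone_onI)
  fix X Y assume "X \<in> {X. pd_mat n X}" "Y \<in> {X. pd_mat n X}" and XY: "loewner_le n X Y"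
  then have X: "pd_mat n X" and Y: "pd_mat n Y" by auto
  then have C: "X \<in> carrier_mat n n" "Y \<in> carrier_mat n n"
    by (auto simp: pd_mat_def hermitian_mat_def)
  \<comment> \<open>The Loewner order is restated as a pointwise comparison of quadratic forms, the
    shape in which it passes through congruences.\<close>
  have "(X *\<^sub>v v) \<bullet>c v \<le> (Y *\<^sub>v v) \<bullet>c v" if v: "v \<in> carrier_vec n" for v
  proof -
    have "0 \<le> ((Y - X) *\<^sub>v v) \<bullet>c v" using XY v unfolding loewner_le_def psd_mat_def by blast
    also have "\<dots> = (Y *\<^sub>v v) \<bullet>c v - (X *\<^sub>v v) \<bullet>c v"
      using C v by (simp add: minus_mult_distrib_mat_vec minus_scalar_prod_distrib[of _ n])
    finally show ?thesis by simp
  qed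
  then show "log_det_diff P X \<ge> log_det_diff P Y"
    using log_det_diff_antimono[OF X Y _ assms(1,2)] vec_space.full_rank_injective[OF assms(2,3)]
    by blast
qed

end
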